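(* Let $A$ be a commutative ring, let $W$ be a multiplicative subset of $A$, and suppose that $A$ is $W$-Egyptian. Let $R$ be a commutative $A$-algebra with structure map $\phi: A\to R$, finitely generated as an $A$-algebra by elements $u_1,\ldots,u_t\in R$, and let $u=\prod_{j=1}^t u_j$. Let $R_u$ be the localization of $R$ at the powers of $u$, let $\ell: R\to R_u$ be the localization map, and let $V$ be the multiplicative subset of $R_u$ generated by $\ell(\phi(W))\cup\{u, u_1^{-1},\ldots,u_t^{-1}\}$, where $u$ and $u_i^{-1}$ denote $\ell(u)$ and the inverse $\ell(u_i)^{-1}$ in $R_u$. Then $R_u$ is $V$-Egyptian.
   Context: Rings are commutative with identity. A multiplicative set in a ring is a subset containing $1$ and closed under multiplication ($0$ is allowed to belong to it); the multiplicative set generated by a subset is the smallest multiplicative set containing it. For a ring $S$ and a multiplicative set $U\subseteq S$, $U^{-1}S$ denotes the localization. An element $c\in U^{-1}S$ is called $U$-Egyptian if it can be written as a finite (possibly empty) sum of reciprocals $\frac{1}{w_1}+\cdots+\frac{1}{w_n}$ in $U^{-1}S$ with all $w_i\in U$ (repetitions allowed). An element $b\in S$ is $U$-Egyptian if $\frac{b}{1}\in U^{-1}S$ is. The ring $S$ is $U$-Egyptian if every nonzero element of $S$ is $U$-Egyptian. *)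

theory Defs
  imports "HOL-Algebra.Generated_Rings"
begin

section \<open>Localization of a commutative ring at a multiplicative set\<close>

text \<open>
  A multiplicative set in \<open>S\<close> is a subset \<open>U\<close> with \<open>submonoid U S\<close>.
  The factor \<open>v\<close> is needed because \<open>U\<close> may contain zero divisors, or even zero, in which
  case the localization is the zero ring.
\<close>

definition frac_rel :: "('a, 'm) ring_scheme \<Rightarrow> 'a set \<Rightarrow> (('a \<times> 'a) \<times> ('a \<times> 'a)) set" where
  "frac_rel S U =
     {((a, s), (b, t)). a \<in> carrier S \<and> s \<in> U \<and> b \<in> carrier S \<and> t \<in> U \<and>
        (\<exists>v\<in>U. v \<otimes>\<^bsub>S\<^esub> (t \<otimes>\<^bsub>S\<^esub> a) = v \<otimes>\<^bsub>S\<^esub> (s \<otimes>\<^bsub>S\<^esub> b))}"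

definition fraction :: "('a, 'm) ring_scheme \<Rightarrow> 'a set \<Rightarrow> 'a \<Rightarrow> 'a \<Rightarrow> ('a \<times> 'a) set" where
  "fraction S U a s = frac_rel S U `` {(a, s)}"

text \<open>The unions below range over all representatives of the two classes; each is a union of
  identical classes, by lemmas \<open>fraction_mult\<close> and \<open>fraction_add\<close>.\<close>

definition localization :: "('a, 'm) ring_scheme \<Rightarrow> 'a set \<Rightarrow> ('a \<times> 'a) set ring" where
  "localization S U =
     \<lparr> carrier = (carrier S \<times> U) // frac_rel S U,
       mult = (\<lambda>x y. \<Union>(a, s)\<in>x. \<Union>(b, t)\<in>y. fraction S U (a \<otimes>\<^bsub>S\<^esub> b) (s \<otimes>\<^bsub>S\<^esub> t)),
       one = fraction S U \<one>\<^bsub>S\<^esub> \<one>\<^bsub>S\<^esub>,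
       zero = fraction S U \<zero>\<^bsub>S\<^esub> \<one>\<^bsub>S\<^esub>,
       add = (\<lambda>x y. \<Union>(a, s)\<in>x. \<Union>(b, t)\<in>y.
                fraction S U (t \<otimes>\<^bsub>S\<^esub> a \<oplus>\<^bsub>S\<^esub> s \<otimes>\<^bsub>S\<^esub> b) (s \<otimes>\<^bsub>S\<^esub> t)) \<rparr>"

definition loc_map :: "('a, 'm) ring_scheme \<Rightarrow> 'a set \<Rightarrow> 'a \<Rightarrow> ('a \<times> 'a) set" where
  "loc_map S U a = fraction S U a \<one>\<^bsub>S\<^esub>"

definition powers :: "('a, 'm) ring_scheme \<Rightarrow> 'a \<Rightarrow> 'a set" where
  "powers S x = {x [^]\<^bsub>S\<^esub> n | n :: nat. True}"

definition mult_set_generated :: "('a, 'm) ring_scheme \<Rightarrow> 'a set \<Rightarrow> 'a set" where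
  "mult_set_generated S H = \<Inter> {T. submonoid T S \<and> H \<subseteq> T}"


section \<open>Egyptian elements and rings\<close>

definition egyptian_sum :: "('a, 'm) ring_scheme \<Rightarrow> 'a set \<Rightarrow> ('a \<times> 'a) set \<Rightarrow> bool" where
  "egyptian_sum S U c \<longleftrightarrow>
     (\<exists>(n::nat) w. w \<in> {1..n} \<rightarrow> U \<and>
        c = (\<Oplus>\<^bsub>localization S U\<^esub> i\<in>{1..n}. fraction S U \<one>\<^bsub>S\<^esub> (w i)))"

definition egyptian_elem :: "('a, 'm) ring_scheme \<Rightarrow> 'a set \<Rightarrow> 'a \<Rightarrow> bool" where
  "egyptian_elem S U b \<longleftrightarrow> egyptian_sum S U (loc_map S U b)"

definition egyptian_ring :: "('a, 'm) ring_scheme \<Rightarrow> 'a set \<Rightarrow> bool" where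
  "egyptian_ring S U \<longleftrightarrow> (\<forall>b\<in>carrier S. b \<noteq> \<zero>\<^bsub>S\<^esub> \<longrightarrow> egyptian_elem S U b)"


section \<open>The localization is a commutative ring\<close>

locale mult_set = cring S + submonoid U S for S (structure) and U
begin

lemma frac_rel_iff:
  "((a, s), (b, t)) \<in> frac_rel S U \<longleftrightarrow> a \<in> carrier S \<and> s \<in> U \<and> b \<in> carrier S \<and> t \<in> U \<and>
     (\<exists>v\<in>U. v \<otimes> (t \<otimes> a) = v \<otimes> (s \<otimes> b))"
  by (simp add: frac_rel_def)

lemma equiv_frac_rel: "equiv (carrier S \<times> U) (frac_rel S U)"
proof (rule equivI)
  show "frac_rel S U \<subseteq> (carrier S \<times> U) \<times> (carrier S \<times> U)"
    by (auto simp: frac_rel_def)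
  show "refl_on (carrier S \<times> U) (frac_rel S U)"
    by (auto simp: refl_on_def frac_rel_def)
  show "sym (frac_rel S U)"
    by (auto simp: sym_def frac_rel_def) (metis)
  show "trans (frac_rel S U)"
  proof (rule transI, clarify)
    fix a s b t c r
    assume "((a, s), (b, t)) \<in> frac_rel S U" "((b, t), (c, r)) \<in> frac_rel S U"
    then obtain v w where
      C: "a \<in> carrier S" "s \<in> U" "b \<in> carrier S" "t \<in> U" "c \<in> carrier S" "r \<in> U"
         "v \<in> U" "w \<in> U"
      and v: "v \<otimes> (t \<otimes> a) = v \<otimes> (s \<otimes> b)" and w: "w \<otimes> (r \<otimes> b) = w \<otimes> (t \<otimes> c)"
      by (auto simp: frac_rel_iff)
    have "(v \<otimes> w \<otimes> t) \<otimes> (r \<otimes> a) = w \<otimes> r \<otimes> (v \<otimes> (t \<otimes> a))"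
      using C by (simp add: m_ac)
    also have "\<dots> = v \<otimes> s \<otimes> (w \<otimes> (r \<otimes> b))"
      unfolding v using C by (simp add: m_ac)
    also have "\<dots> = (v \<otimes> w \<otimes> t) \<otimes> (s \<otimes> c)"
      unfolding w using C by (simp add: m_ac)
    finally show "((a, s), (c, r)) \<in> frac_rel S U"
      unfolding frac_rel_iff using C by blast
  qed
qed

lemma fraction_eq_iff:
  assumes "a \<in> carrier S" "s \<in> U" "b \<in> carrier S" "t \<in> U"
  shows "fraction S U a s = fraction S U b t \<longleftrightarrow> (\<exists>v\<in>U. v \<otimes> (t \<otimes> a) = v \<otimes> (s \<otimes> b))"
  unfolding fraction_def
  using eq_equiv_class_iff[OF equiv_frac_rel, of "(a, s)" "(b, t)"] assms
  by (simp add: frac_rel_iff)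

lemma fractionI:
  assumes "a \<in> carrier S" "s \<in> U" "b \<in> carrier S" "t \<in> U" "t \<otimes> a = s \<otimes> b"
  shows "fraction S U a s = fraction S U b t"
  using assms fraction_eq_iff by (metis one_closed)

lemma fraction_closed:
  "a \<in> carrier S \<Longrightarrow> s \<in> U \<Longrightarrow> fraction S U a s \<in> carrier (localization S U)"
  by (auto simp: localization_def fraction_def intro: quotientI)

lemma fraction_cases:
  assumes "x \<in> carrier (localization S U)"
  obtains a s where "a \<in> carrier S" "s \<in> U" "x = fraction S U a s"
  using assms by (auto simp: localization_def fraction_def elim!: quotientE)

lemma mem_fraction:
  assumes "a \<in> carrier S" "s \<in> U"
  shows "(a, s) \<in> fraction S U a s"
  using equiv_class_self[OF equiv_frac_rel, of "(a, s)"] assms by (simp add: fraction_def)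

lemma mem_fractionD:
  assumes "(b, t) \<in> fraction S U a s" "a \<in> carrier S" "s \<in> U"
  shows "b \<in> carrier S" "t \<in> U" "fraction S U b t = fraction S U a s"
  using assms equiv_class_eq[OF equiv_frac_rel, of "(a, s)" "(b, t)"]
  by (auto simp: fraction_def frac_rel_iff)

lemma fraction_UN:
  assumes "a \<in> carrier S" "s \<in> U" "b \<in> carrier S" "t \<in> U"
    and "\<And>a' s' b' t'. \<lbrakk>a' \<in> carrier S; s' \<in> U; b' \<in> carrier S; t' \<in> U;
           fraction S U a' s' = fraction S U a s; fraction S U b' t' = fraction S U b t\<rbrakk>
         \<Longrightarrow> f a' s' b' t' = f a s b t"
  shows "(\<Union>(a', s')\<in>fraction S U a s. \<Union>(b', t')\<in>fraction S U b t. f a' s' b' t') = f a s b t"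
proof -
  have "f a' s' b' t' = f a s b t"
    if "(a', s') \<in> fraction S U a s" "(b', t') \<in> fraction S U b t" for a' s' b' t'
    using mem_fractionD[OF that(1) assms(1,2)] mem_fractionD[OF that(2) assms(3,4)] assms(5) by blast
  then have "(\<Union>q\<in>fraction S U b t. case q of (b', t') \<Rightarrow> f a' s' b' t') = f a s b t"
    if "(a', s') \<in> fraction S U a s" for a' s'
    using that mem_fraction[OF assms(3,4)] by (intro UN_constant_eq) auto
  then show ?thesis
    using mem_fraction[OF assms(1,2)] by (intro UN_constant_eq) auto
qed

lemma fraction_mult:
  assumes C: "a \<in> carrier S" "s \<in> U" "b \<in> carrier S" "t \<in> U"
  shows "fraction S U a s \<otimes>\<^bsub>localization S U\<^esub> fraction S U b t = fraction S U (a \<otimes> b) (s \<otimes> t)"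
proof -
  have "(\<Union>(a', s')\<in>fraction S U a s. \<Union>(b', t')\<in>fraction S U b t. fraction S U (a' \<otimes> b') (s' \<otimes> t'))
        = fraction S U (a \<otimes> b) (s \<otimes> t)"
  proof (rule fraction_UN[OF C])
    fix a' s' b' t'
    assume C': "a' \<in> carrier S" "s' \<in> U" "b' \<in> carrier S" "t' \<in> U"
      and "fraction S U a' s' = fraction S U a s" "fraction S U b' t' = fraction S U b t"
    then obtain v w where vw: "v \<in> U" "w \<in> U"
      and v: "v \<otimes> (s \<otimes> a') = v \<otimes> (s' \<otimes> a)" and w: "w \<otimes> (t \<otimes> b') = w \<otimes> (t' \<otimes> b)"
      using C by (auto simp: fraction_eq_iff)
    have "(v \<otimes> w) \<otimes> ((s \<otimes> t) \<otimes> (a' \<otimes> b')) = (v \<otimes> (s \<otimes> a')) \<otimes> (w \<otimes> (t \<otimes> b'))"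
      using C C' vw by (simp add: m_ac)
    also have "\<dots> = (v \<otimes> w) \<otimes> ((s' \<otimes> t') \<otimes> (a \<otimes> b))"
      unfolding v w using C C' vw by (simp add: m_ac)
    finally show "fraction S U (a' \<otimes> b') (s' \<otimes> t') = fraction S U (a \<otimes> b) (s \<otimes> t)"
      using C C' vw by (subst fraction_eq_iff) auto
  qed
  then show ?thesis by (simp add: localization_def)
qed

lemma fraction_add:
  assumes C: "a \<in> carrier S" "s \<in> U" "b \<in> carrier S" "t \<in> U"
  shows "fraction S U a s \<oplus>\<^bsub>localization S U\<^esub> fraction S U b t =
           fraction S U (t \<otimes> a \<oplus> s \<otimes> b) (s \<otimes> t)"
proof -
  have "(\<Union>(a', s')\<in>fraction S U a s. \<Union>(b', t')\<in>fraction S U b t.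
           fraction S U (t' \<otimes> a' \<oplus> s' \<otimes> b') (s' \<otimes> t'))
        = fraction S U (t \<otimes> a \<oplus> s \<otimes> b) (s \<otimes> t)"
  proof (rule fraction_UN[OF C])
    fix a' s' b' t'
    assume C': "a' \<in> carrier S" "s' \<in> U" "b' \<in> carrier S" "t' \<in> U"
      and "fraction S U a' s' = fraction S U a s" "fraction S U b' t' = fraction S U b t"
    then obtain v w where vw: "v \<in> U" "w \<in> U"
      and v: "v \<otimes> (s \<otimes> a') = v \<otimes> (s' \<otimes> a)" and w: "w \<otimes> (t \<otimes> b') = w \<otimes> (t' \<otimes> b)"
      using C by (auto simp: fraction_eq_iff)
    have "(v \<otimes> w) \<otimes> ((s \<otimes> t) \<otimes> (t' \<otimes> a' \<oplus> s' \<otimes> b')) =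
            (w \<otimes> t \<otimes> t') \<otimes> (v \<otimes> (s \<otimes> a')) \<oplus> (v \<otimes> s \<otimes> s') \<otimes> (w \<otimes> (t \<otimes> b'))"
      using C C' vw by (simp add: m_ac r_distr)
    also have "\<dots> = (v \<otimes> w) \<otimes> ((s' \<otimes> t') \<otimes> (t \<otimes> a \<oplus> s \<otimes> b))"
      unfolding v w using C C' vw by (simp add: m_ac r_distr)
    finally show "fraction S U (t' \<otimes> a' \<oplus> s' \<otimes> b') (s' \<otimes> t') =
                  fraction S U (t \<otimes> a \<oplus> s \<otimes> b) (s \<otimes> t)"
      using C C' vw by (subst fraction_eq_iff) auto
  qed
  then show ?thesis by (simp add: localization_def)
qed

lemma one_localization: "\<one>\<^bsub>localization S U\<^esub> = fraction S U \<one> \<one>"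
  and zero_localization: "\<zero>\<^bsub>localization S U\<^esub> = fraction S U \<zero> \<one>"
  by (simp_all add: localization_def)

lemma cring_localization: "cring (localization S U)"
proof (rule cringI)
  show "abelian_group (localization S U)"
  proof (rule abelian_groupI)
    fix x y assume "x \<in> carrier (localization S U)" "y \<in> carrier (localization S U)"
    then show "x \<oplus>\<^bsub>localization S U\<^esub> y \<in> carrier (localization S U)"
      by (elim fraction_cases) (simp add: fraction_add fraction_closed)
  next
    show "\<zero>\<^bsub>localization S U\<^esub> \<in> carrier (localization S U)"
      by (simp add: zero_localization fraction_closed)
  next
    fix x y z
    assume "x \<in> carrier (localization S U)" "y \<in> carrier (localization S U)"
      "z \<in> carrier (localization S U)"
    then show "x \<oplus>\<^bsub>localization S U\<^esub> y \<oplus>\<^bsub>localization S U\<^esub> z =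
               x \<oplus>\<^bsub>localization S U\<^esub> (y \<oplus>\<^bsub>localization S U\<^esub> z)"
      by (elim fraction_cases) (simp add: fraction_add m_ac a_ac r_distr)
  next
    fix x y assume "x \<in> carrier (localization S U)" "y \<in> carrier (localization S U)"
    then show "x \<oplus>\<^bsub>localization S U\<^esub> y = y \<oplus>\<^bsub>localization S U\<^esub> x"
      by (elim fraction_cases) (simp add: fraction_add m_comm a_comm)
  next
    fix x assume "x \<in> carrier (localization S U)"
    then show "\<zero>\<^bsub>localization S U\<^esub> \<oplus>\<^bsub>localization S U\<^esub> x = x"
      by (elim fraction_cases) (simp add: fraction_add zero_localization)
  next
    fix x assume "x \<in> carrier (localization S U)"
    then obtain a s where C: "a \<in> carrier S" "s \<in> U" and x: "x = fraction S U a s"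
      by (rule fraction_cases)
    have "fraction S U (\<ominus> a) s \<oplus>\<^bsub>localization S U\<^esub> x = \<zero>\<^bsub>localization S U\<^esub>"
      unfolding x zero_localization using C
      by (simp add: fraction_add r_minus l_neg) (rule fractionI; simp)
    then show "\<exists>y\<in>carrier (localization S U).
                 y \<oplus>\<^bsub>localization S U\<^esub> x = \<zero>\<^bsub>localization S U\<^esub>"
      using C fraction_closed[of "\<ominus> a" s] by auto
  qed
  show "Group.comm_monoid (localization S U)"
  proof (rule comm_monoidI)
    fix x y assume "x \<in> carrier (localization S U)" "y \<in> carrier (localization S U)"
    then show "x \<otimes>\<^bsub>localization S U\<^esub> y \<in> carrier (localization S U)"
      by (elim fraction_cases) (simp add: fraction_mult fraction_closed)
  next
    show "\<one>\<^bsub>localization S U\<^esub> \<in> carrier (localization S U)"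
      by (simp add: one_localization fraction_closed)
  next
    fix x y z
    assume "x \<in> carrier (localization S U)" "y \<in> carrier (localization S U)"
      "z \<in> carrier (localization S U)"
    then show "x \<otimes>\<^bsub>localization S U\<^esub> y \<otimes>\<^bsub>localization S U\<^esub> z =
               x \<otimes>\<^bsub>localization S U\<^esub> (y \<otimes>\<^bsub>localization S U\<^esub> z)"
      by (elim fraction_cases) (simp add: fraction_mult m_ac)
  next
    fix x assume "x \<in> carrier (localization S U)"
    then show "\<one>\<^bsub>localization S U\<^esub> \<otimes>\<^bsub>localization S U\<^esub> x = x"
      by (elim fraction_cases) (simp add: fraction_mult one_localization)
  next
    fix x y assume "x \<in> carrier (localization S U)" "y \<in> carrier (localization S U)"
    then show "x \<otimes>\<^bsub>localization S U\<^esub> y = y \<otimes>\<^bsub>localization S U\<^esub> x"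
      by (elim fraction_cases) (simp add: fraction_mult m_comm)
  qed
  fix x y z
  assume "x \<in> carrier (localization S U)" "y \<in> carrier (localization S U)"
    "z \<in> carrier (localization S U)"
  then obtain a r b s c t where
    C: "a \<in> carrier S" "r \<in> U" "b \<in> carrier S" "s \<in> U" "c \<in> carrier S" "t \<in> U"
    and [simp]: "x = fraction S U a r" "y = fraction S U b s" "z = fraction S U c t"
    by (elim fraction_cases) blast
  show "(x \<oplus>\<^bsub>localization S U\<^esub> y) \<otimes>\<^bsub>localization S U\<^esub> z =
        x \<otimes>\<^bsub>localization S U\<^esub> z \<oplus>\<^bsub>localization S U\<^esub> y \<otimes>\<^bsub>localization S U\<^esub> z"
  proof -
    let ?n = "(s \<otimes> a \<oplus> r \<otimes> b) \<otimes> c" and ?d = "r \<otimes> s \<otimes> t"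
    have n: "?n \<in> carrier S" and d: "?d \<in> U" and t: "t \<in> carrier S"
      using C by auto
    have "(s \<otimes> t) \<otimes> (a \<otimes> c) = t \<otimes> ((s \<otimes> a) \<otimes> c)"
      "(r \<otimes> t) \<otimes> (b \<otimes> c) = t \<otimes> ((r \<otimes> b) \<otimes> c)"
      using C by (simp_all add: m_ac)
    then have num: "(s \<otimes> t) \<otimes> (a \<otimes> c) \<oplus> (r \<otimes> t) \<otimes> (b \<otimes> c) = t \<otimes> ?n"
      using C by (simp add: l_distr r_distr)
    have den: "(r \<otimes> t) \<otimes> (s \<otimes> t) = t \<otimes> ?d"
      using C by (simp add: m_ac)
    have "fraction S U ?n ?d = fraction S U (t \<otimes> ?n) (t \<otimes> ?d)"
      proof (rule fractionI)
      show "t \<otimes> ?d \<otimes> ?n = ?d \<otimes> (t \<otimes> ?n)"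
        using m_assoc[of ?d t ?n] m_comm[of t ?d] n t mem_carrier[OF d] by simp
    qed (use n d t C(6) in blast)+
    then show ?thesis
      using C by (simp add: fraction_add fraction_mult num den)
  qed
qed

lemma loc_map_hom: "loc_map S U \<in> ring_hom S (localization S U)"
  by (rule ring_hom_memI)
     (auto simp: loc_map_def fraction_add fraction_mult one_localization fraction_closed)

text \<open>The class \<open>fraction S U \<one> w\<close> is the reciprocal of \<open>w\<close> in the localization.\<close>

lemma fraction_one_eq_inv:
  assumes "w \<in> U"
  shows "loc_map S U w \<in> Units (localization S U)"
    and "inv\<^bsub>localization S U\<^esub> (loc_map S U w) = fraction S U \<one> w"
proof -
  interpret L: cring "localization S U" by (rule cring_localization)
  have C: "loc_map S U w \<in> carrier (localization S U)" "fraction S U \<one> w \<in> carrier (localization S U)"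
    using assms by (auto simp: loc_map_def fraction_closed)
  have 1: "loc_map S U w \<otimes>\<^bsub>localization S U\<^esub> fraction S U \<one> w = \<one>\<^bsub>localization S U\<^esub>"
    unfolding loc_map_def one_localization using assms
    by (simp add: fraction_mult) (rule fractionI; simp)
  with C have 2: "fraction S U \<one> w \<otimes>\<^bsub>localization S U\<^esub> loc_map S U w = \<one>\<^bsub>localization S U\<^esub>"
    using L.m_comm by metis
  show "loc_map S U w \<in> Units (localization S U)"
    unfolding Units_def using C 1 2 by blast
  show "inv\<^bsub>localization S U\<^esub> (loc_map S U w) = fraction S U \<one> w"
    using L.comm_inv_char[OF C 1] .
qed

end

lemma (in cring) submonoid_powers:
  assumes "x \<in> carrier R"
  shows "submonoid (powers R x) R"
proof
  show "powers R x \<subseteq> carrier R" using assms by (auto simp: powers_def)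
  show "\<one> \<in> powers R x" by (auto simp: powers_def intro: exI[of _ "0 :: nat"])
  show "y \<otimes> z \<in> powers R x" if "y \<in> powers R x" "z \<in> powers R x" for y z
    using that assms by (auto simp: powers_def nat_pow_mult)
qed

end

theory Submission
  imports Defs "HOL-Algebra.Divisibility"
begin

text \<open>
  The elements of \<open>R\<^sub>u\<close> that are \<open>V\<close>-Egyptian contain \<open>0\<close> and are closed under sums and products,
  since products of reciprocals of elements of \<open>V\<close> are again such reciprocals. They contain the
  image of \<open>A\<close> (push an expression as a sum of reciprocals forward along \<open>A \<rightarrow> R\<^sub>u\<close>), hence
  also \<open>-1\<close>; each \<open>u\<^sub>j\<close>, being the reciprocal of its inverse; and the reciprocal of \<open>u\<close>.
  These elements generate \<open>R\<^sub>u\<close>.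
\<close>

lemma (in cring) submonoid_mult_set_generated:
  assumes "H \<subseteq> carrier R"
  shows "submonoid (mult_set_generated R H) R"
proof
  \<comment> \<open>The carrier is itself one of the intersected sets, so the intersection stays
    inside it.\<close>
  have "submonoid (carrier R) R"
    by unfold_locales auto
  then show "mult_set_generated R H \<subseteq> carrier R"
    using assms by (auto simp: mult_set_generated_def)
qed (auto simp: mult_set_generated_def submonoid.one_closed submonoid.m_closed)

lemma subset_mult_set_generated: "H \<subseteq> mult_set_generated S H"
  by (auto simp: mult_set_generated_def)

section \<open>Sums of reciprocals in a localization\<close>

context mult_set
begin

lemma egyptian_sum_zero: "egyptian_sum S U \<zero>\<^bsub>localization S U\<^esub>"
proof -
  interpret L: cring "localization S U" by (rule cring_localization)
  show ?thesis
    unfolding egyptian_sum_def by (rule exI[of _ 0]) auto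
qed

lemma egyptian_sum_add_reciprocal:
  assumes "egyptian_sum S U c" "v \<in> U"
  shows "egyptian_sum S U (fraction S U \<one> v \<oplus>\<^bsub>localization S U\<^esub> c)"
proof -
  interpret L: cring "localization S U" by (rule cring_localization)
  obtain n :: nat and w where w: "w \<in> {1..n} \<rightarrow> U"
    and c: "c = (\<Oplus>\<^bsub>localization S U\<^esub> i\<in>{1..n}. fraction S U \<one> (w i))"
    using assms by (auto simp: egyptian_sum_def)
  \<comment> \<open>The new reciprocal goes to the fresh index \<open>Suc n\<close>, so the terms on
    \<open>{1..n}\<close> keep their values.\<close>
  let ?w = "w(Suc n := v)"
  have C: "fraction S U \<one> (w i) \<in> carrier (localization S U)" if "i \<in> {1..n}" for i
    using w that by (intro fraction_closed) auto
  have "(\<Oplus>\<^bsub>localization S U\<^esub> i\<in>{1..n}. fraction S U \<one> (?w i)) = c"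
    unfolding c by (rule L.finsum_cong') (use C in auto)
  moreover have "(\<Oplus>\<^bsub>localization S U\<^esub> i\<in>insert (Suc n) {1..n}. fraction S U \<one> (?w i)) =
      fraction S U \<one> v \<oplus>\<^bsub>localization S U\<^esub> (\<Oplus>\<^bsub>localization S U\<^esub> i\<in>{1..n}. fraction S U \<one> (?w i))"
    using C assms(2) by (subst L.finsum_insert) (auto intro: fraction_closed)
  ultimately have "fraction S U \<one> v \<oplus>\<^bsub>localization S U\<^esub> c =
      (\<Oplus>\<^bsub>localization S U\<^esub> i\<in>{1..Suc n}. fraction S U \<one> (?w i))"
    by (simp add: atLeastAtMostSuc_conv)
  moreover have "?w \<in> {1..Suc n} \<rightarrow> U"
    using w assms(2) by auto
  ultimately show ?thesis
    unfolding egyptian_sum_def by blast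
qed

text \<open>Adding the reciprocals one at a time gives an induction principle free of indices, on
  which the closure properties and the transport along homomorphisms rest.\<close>

lemma egyptian_sum_induct [consumes 1, case_names zero add]:
  assumes "egyptian_sum S U c"
    and zero: "P \<zero>\<^bsub>localization S U\<^esub>"
    and add: "\<And>v x. \<lbrakk>v \<in> U; x \<in> carrier (localization S U); egyptian_sum S U x; P x\<rbrakk>
      \<Longrightarrow> P (fraction S U \<one> v \<oplus>\<^bsub>localization S U\<^esub> x)"
  shows "P c"
proof -
  interpret L: cring "localization S U" by (rule cring_localization)
  obtain n :: nat and w where w: "w \<in> {1..n} \<rightarrow> U"
    and c: "c = (\<Oplus>\<^bsub>localization S U\<^esub> i\<in>{1..n}. fraction S U \<one> (w i))"
    using assms by (auto simp: egyptian_sum_def)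
  let ?s = "\<lambda>m. \<Oplus>\<^bsub>localization S U\<^esub> i\<in>{1..m}. fraction S U \<one> (w i)"
  \<comment> \<open>The induction runs over the partial sums of one fixed \<open>w\<close>; the
    bound on \<open>m\<close> keeps every index where \<open>w\<close> is known to take values in
    \<open>U\<close>.\<close>
  have "P (?s m)" if "m \<le> n" for m
    using that
  proof (induction m)
    case 0
    show ?case using zero by simp
  next
    case (Suc m)
    have U: "w i \<in> U" if "i \<in> {1..Suc m}" for i
      using w Suc.prems that by (auto simp: Pi_iff)
    have "egyptian_sum S U (?s m)"
      unfolding egyptian_sum_def using U by (intro exI[of _ m] exI[of _ w]) auto
    moreover have "?s m \<in> carrier (localization S U)"
      using U by (intro L.finsum_closed) (auto intro!: fraction_closed)
    moreover have "?s (Suc m) = fraction S U \<one> (w (Suc m)) \<oplus>\<^bsub>localization S U\<^esub> ?s m"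
    proof -
      have "{1..Suc m} = insert (Suc m) {1..m}"
        by auto
      then show ?thesis
        using U L.finsum_insert[of "{1..m}" "Suc m" "\<lambda>i. fraction S U \<one> (w i)"]
        by (simp add: Pi_iff fraction_closed)
    qed
    ultimately show ?case
      using Suc add[of "w (Suc m)" "?s m"] U by simp
  qed
  then show ?thesis by (simp add: c)
qed

lemma egyptian_sum_closed:
  assumes "egyptian_sum S U c"
  shows "c \<in> carrier (localization S U)"
proof -
  interpret L: cring "localization S U" by (rule cring_localization)
  show ?thesis
    using assms by (induction rule: egyptian_sum_induct) (auto intro: fraction_closed)
qed

lemma egyptian_sum_reciprocal:
  assumes "v \<in> U"
  shows "egyptian_sum S U (fraction S U \<one> v)"
proof -
  interpret L: cring "localization S U" by (rule cring_localization)
  show ?thesis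
    using egyptian_sum_add_reciprocal[OF egyptian_sum_zero assms] assms
    by (simp add: fraction_closed)
qed

lemma egyptian_sum_add:
  assumes "egyptian_sum S U c" "egyptian_sum S U d"
  shows "egyptian_sum S U (c \<oplus>\<^bsub>localization S U\<^esub> d)"
proof -
  interpret L: cring "localization S U" by (rule cring_localization)
  have d: "d \<in> carrier (localization S U)"
    using assms(2) by (rule egyptian_sum_closed)
  show ?thesis
    using assms(1)
  proof (induction rule: egyptian_sum_induct)
    case zero
    then show ?case using assms(2) d by simp
  next
    case (add v x)
    then show ?case
      using d egyptian_sum_add_reciprocal[OF add(4,1)] by (simp add: L.a_assoc fraction_closed)
  qed
qed

text \<open>Distribute over the sum: the reciprocals of \<open>v\<close> and \<open>w\<close>
  multiply to the reciprocal of their product, which is again in \<open>U\<close>.\<close>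

lemma egyptian_sum_mult_reciprocal:
  assumes "egyptian_sum S U d" "v \<in> U"
  shows "egyptian_sum S U (fraction S U \<one> v \<otimes>\<^bsub>localization S U\<^esub> d)"
proof -
  interpret L: cring "localization S U" by (rule cring_localization)
  show ?thesis
    using assms(1)
  proof (induction rule: egyptian_sum_induct)
    case zero
    then show ?case using assms(2) by (simp add: fraction_closed egyptian_sum_zero)
  next
    case (add w x)
    then show ?case
      using assms(2) egyptian_sum_add_reciprocal[of _ "v \<otimes> w"]
      by (simp add: L.r_distr fraction_closed fraction_mult)
  qed
qed

lemma egyptian_sum_mult:
  assumes "egyptian_sum S U c" "egyptian_sum S U d"
  shows "egyptian_sum S U (c \<otimes>\<^bsub>localization S U\<^esub> d)"
proof -
  interpret L: cring "localization S U" by (rule cring_localization)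
  have d: "d \<in> carrier (localization S U)"
    using assms(2) by (rule egyptian_sum_closed)
  show ?thesis
    using assms(1)
  proof (induction rule: egyptian_sum_induct)
    case zero
    then show ?case using d by (simp add: egyptian_sum_zero)
  next
    case (add v x)
    then show ?case
      using d egyptian_sum_mult_reciprocal[OF assms(2) add(1)]
      by (simp add: L.l_distr fraction_closed egyptian_sum_add)
  qed
qed

section \<open>Egyptian elements of the ring itself\<close>

lemma egyptian_elem_zero: "egyptian_elem S U \<zero>"
  using egyptian_sum_zero by (simp add: egyptian_elem_def loc_map_def zero_localization)

lemma egyptian_elem_add:
  assumes "a \<in> carrier S" "b \<in> carrier S" "egyptian_elem S U a" "egyptian_elem S U b"
  shows "egyptian_elem S U (a \<oplus> b)"
  using assms egyptian_sum_add ring_hom_add[OF loc_map_hom] by (simp add: egyptian_elem_def)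

lemma egyptian_elem_mult:
  assumes "a \<in> carrier S" "b \<in> carrier S" "egyptian_elem S U a" "egyptian_elem S U b"
  shows "egyptian_elem S U (a \<otimes> b)"
  using assms egyptian_sum_mult ring_hom_mult[OF loc_map_hom] by (simp add: egyptian_elem_def)

text \<open>Such an \<open>a\<close> is already a reciprocal inside \<open>S\<close>, hence a sum
  with a single term. This later covers the generators, the identity and the reciprocals of powers
  of \<open>p\<close>.\<close>

lemma egyptian_elem_inverse:
  assumes "a \<in> carrier S" "v \<in> U" "v \<otimes> a = \<one>"
  shows "egyptian_elem S U a"
proof -
  have "loc_map S U a = fraction S U \<one> v"
    unfolding loc_map_def using assms by (intro fractionI) auto
  then show ?thesis
    using egyptian_sum_reciprocal assms(2) by (simp add: egyptian_elem_def)
qed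

section \<open>Transport along ring homomorphisms\<close>

text \<open>This is the well-definedness of the induced map of localizations: applying
  \<open>f\<close> to the factor \<open>v\<close> that witnesses equality in the source gives a
  witness in the target.\<close>

lemma fraction_hom_cong:
  assumes "mult_set T V" "f \<in> ring_hom S T" "f ` U \<subseteq> V"
    and C: "a \<in> carrier S" "s \<in> U" "b \<in> carrier S" "t \<in> U"
    and eq: "fraction S U a s = fraction S U b t"
  shows "fraction T V (f a) (f s) = fraction T V (f b) (f t)"
proof -
  interpret T: mult_set T V by fact
  obtain v where v: "v \<in> U" "v \<otimes> (t \<otimes> a) = v \<otimes> (s \<otimes> b)"
    using eq C by (auto simp: fraction_eq_iff)
  have "f v \<otimes>\<^bsub>T\<^esub> (f t \<otimes>\<^bsub>T\<^esub> f a) = f v \<otimes>\<^bsub>T\<^esub> (f s \<otimes>\<^bsub>T\<^esub> f b)"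
    using arg_cong[OF v(2), of f] C v(1) by (simp add: ring_hom_mult[OF assms(2)])
  moreover have "f a \<in> carrier T" "f b \<in> carrier T" "f s \<in> V" "f t \<in> V" "f v \<in> V"
    using C v(1) assms(3) ring_hom_closed[OF assms(2)] by auto
  ultimately show ?thesis
    by (auto simp: T.fraction_eq_iff)
qed

lemma egyptian_elem_hom:
  assumes "mult_set T V" and hom: "f \<in> ring_hom S T" and sub: "f ` U \<subseteq> V"
    and a: "a \<in> carrier S" "egyptian_elem S U a"
  shows "egyptian_elem T V (f a)"
proof -
  interpret T: mult_set T V by fact
  have fV: "f s \<in> V" if "s \<in> U" for s
    using that sub by auto
  have f0: "f \<zero> = \<zero>\<^bsub>T\<^esub>"
    using ring_hom_zero[OF hom] ring_axioms T.ring_axioms by blast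
  note h = ring_hom_closed[OF hom] ring_hom_mult[OF hom] ring_hom_add[OF hom] ring_hom_one[OF hom]
  \<comment> \<open>The induced map is not constructed as a function. The induction instead carries
    some representative of \<open>c\<close> whose image under \<open>f\<close> is an Egyptian
    fraction in the target.\<close>
  have "\<exists>b\<in>carrier S. \<exists>s\<in>U. c = fraction S U b s \<and> egyptian_sum T V (fraction T V (f b) (f s))"
    if "egyptian_sum S U c" for c
    using that
  proof (induction rule: egyptian_sum_induct)
    case zero
    have "egyptian_sum T V (fraction T V (f \<zero>) (f \<one>))"
      using T.egyptian_sum_zero by (simp add: f0 h T.zero_localization)
    then show ?case
      unfolding zero_localization by (intro bexI[of _ \<zero>] bexI[of _ \<one>] conjI refl) auto
  next
    case (add v x)
    then obtain b s where bs: "b \<in> carrier S" "s \<in> U" "x = fraction S U b s"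
      and eg: "egyptian_sum T V (fraction T V (f b) (f s))"
      by blast
    have "fraction S U \<one> v \<oplus>\<^bsub>localization S U\<^esub> x = fraction S U (s \<otimes> \<one> \<oplus> v \<otimes> b) (v \<otimes> s)"
      using bs add(1) by (simp add: fraction_add)
    moreover have "fraction T V (f (s \<otimes> \<one> \<oplus> v \<otimes> b)) (f (v \<otimes> s)) =
        fraction T V \<one>\<^bsub>T\<^esub> (f v) \<oplus>\<^bsub>localization T V\<^esub> fraction T V (f b) (f s)"
      using bs add(1) fV by (simp add: T.fraction_add h)
    ultimately show ?case
      using T.egyptian_sum_add_reciprocal[OF eg fV[OF add(1)]] bs add(1)
      by (intro bexI[of _ "s \<otimes> \<one> \<oplus> v \<otimes> b"] bexI[of _ "v \<otimes> s"]) auto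
  qed
  then obtain b s where bs: "b \<in> carrier S" "s \<in> U" "fraction S U a \<one> = fraction S U b s"
    and eg: "egyptian_sum T V (fraction T V (f b) (f s))"
    using a(2) unfolding egyptian_elem_def loc_map_def by blast
  \<comment> \<open>The representative found by the induction need not be \<open>a\<close> over one,
    so independence of the representative is used here.\<close>
  have "fraction T V (f a) (f \<one>) = fraction T V (f b) (f s)"
    using fraction_hom_cong[OF assms(1-3) a(1) _ bs(1,2,3)] by simp
  then show ?thesis
    using eg by (simp add: egyptian_elem_def loc_map_def h)
qed

text \<open>Zero is a separate case because \<open>egyptian_ring\<close> speaks only of nonzero
  elements, while the image of every element is wanted.\<close>

lemma egyptian_ring_hom:
  assumes "egyptian_ring S U" "mult_set T V" "f \<in> ring_hom S T" "f ` U \<subseteq> V" "a \<in> carrier S"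
  shows "egyptian_elem T V (f a)"
  using egyptian_elem_hom[OF assms(2-5)] egyptian_elem_zero assms(1,5)
  by (cases "a = \<zero>") (auto simp: egyptian_ring_def)

end

section \<open>Inverting the factors of a product\<close>

text \<open>The factor \<open>u j\<close> divides \<open>p\<close>, whose image is a unit, and a
  divisor of a unit in a commutative ring is a unit.\<close>

lemma (in cring) Units_loc_map_factor:
  assumes "finite J" "u \<in> J \<rightarrow> carrier R" "j \<in> J" and p: "p = (\<Otimes>i\<in>J. u i)"
  shows "loc_map R (powers R p) (u j) \<in> Units (localization R (powers R p))"
proof -
  have C: "p \<in> carrier R" "u j \<in> carrier R" "(\<Otimes>i\<in>J - {j}. u i) \<in> carrier R"
    using assms by (auto intro!: finprod_closed)
  interpret P: mult_set R "powers R p"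
    by (intro mult_set.intro is_cring submonoid_powers C)
  interpret L: cring "localization R (powers R p)"
    by (rule P.cring_localization)
  have "p \<in> powers R p"
    using C(1) by (auto simp: powers_def intro!: exI[of _ "1 :: nat"])
  moreover have "p = u j \<otimes> (\<Otimes>i\<in>J - {j}. u i)"
    unfolding p using assms(1-3) finprod_insert[of "J - {j}" j u]
    by (auto simp: insert_absorb Pi_iff)
  ultimately have "loc_map R (powers R p) (u j) \<otimes>\<^bsub>localization R (powers R p)\<^esub>
      loc_map R (powers R p) (\<Otimes>i\<in>J - {j}. u i) \<in> Units (localization R (powers R p))"
    using P.fraction_one_eq_inv(1) ring_hom_mult[OF P.loc_map_hom C(2,3)] by metis
  then show ?thesis
    using L.unit_factor ring_hom_closed[OF P.loc_map_hom] C by blast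
qed

section \<open>The localized algebra\<close>

theorem theorem2p12:
  fixes A :: "('a, 'm) ring_scheme" and R :: "('b, 'n) ring_scheme"
    and W :: "'a set" and \<phi> :: "'a \<Rightarrow> 'b" and t :: nat and u :: "nat \<Rightarrow> 'b"
  assumes "cring A" and "submonoid W A" and "egyptian_ring A W"
    and "cring R" and "\<phi> \<in> ring_hom A R"
    and "u \<in> {1..t} \<rightarrow> carrier R"
    and "carrier R = generate_ring R (\<phi> ` carrier A \<union> u ` {1..t})"
  shows
    "let p = (\<Otimes>\<^bsub>R\<^esub> j\<in>{1..t}. u j);
         R\<^sub>u = localization R (powers R p);
         l = loc_map R (powers R p);
         V = mult_set_generated R\<^sub>u
               (l ` \<phi> ` W \<union> {l p} \<union> (\<lambda>j. inv\<^bsub>R\<^sub>u\<^esub> (l (u j))) ` {1..t})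
     in egyptian_ring R\<^sub>u V"
proof -
  define p where "p = (\<Otimes>\<^bsub>R\<^esub> j\<in>{1..t}. u j)"
  define L where "L = localization R (powers R p)"
  define l where "l = loc_map R (powers R p)"
  define H where "H = l ` \<phi> ` W \<union> {l p} \<union> (\<lambda>j. inv\<^bsub>L\<^esub> (l (u j))) ` {1..t}"
  define V where "V = mult_set_generated L H"
  interpret A: mult_set A W
    by (intro mult_set.intro assms)
  interpret R: cring R by fact
  have p: "p \<in> carrier R"
    unfolding p_def using assms(6) by (intro R.finprod_closed) auto
  interpret P: mult_set R "powers R p"
    by (intro mult_set.intro assms R.submonoid_powers p)
  interpret L: cring L
    unfolding L_def by (rule P.cring_localization)
  have l: "l \<in> ring_hom R L"
    unfolding l_def L_def by (rule P.loc_map_hom)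
  interpret l: ring_hom_ring R L l
    using l by unfold_locales auto
  have \<phi>C: "\<phi> a \<in> carrier R" if "a \<in> carrier A" for a
    using that ring_hom_closed[OF assms(5)] by blast
  have unit: "l (u j) \<in> Units L" if "j \<in> {1..t}" for j
    unfolding l_def L_def using that assms(6) p_def by (intro R.Units_loc_map_factor) auto
  have H: "H \<subseteq> carrier L"
    using unit \<phi>C p by (auto simp: H_def)
  \<comment> \<open>Two localizations are in play: \<open>L\<close> inverts \<open>p\<close> in
    \<open>R\<close>, while being Egyptian with respect to \<open>V\<close> is tested in the further
    localization of \<open>L\<close> at \<open>V\<close>.\<close>
  interpret V: mult_set L V
    unfolding V_def by (intro mult_set.intro L.is_cring L.submonoid_mult_set_generated H)
  have HV: "h \<in> V" if "h \<in> H" for h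
    unfolding V_def using that by (rule subsetD[OF subset_mult_set_generated])
  have phi: "egyptian_elem L V (l (\<phi> a))" if "a \<in> carrier A" for a
  proof -
    have "l \<circ> \<phi> \<in> ring_hom A L"
      using ring_hom_trans assms(5) l by blast
    moreover have "(l \<circ> \<phi>) ` W \<subseteq> V"
      using HV by (auto simp: H_def)
    ultimately show ?thesis
      using A.egyptian_ring_hom[OF assms(3) V.mult_set_axioms _ _ that, of "l \<circ> \<phi>"] by simp
  qed
  have uj: "egyptian_elem L V (l (u j))" if "j \<in> {1..t}" for j
  proof (rule V.egyptian_elem_inverse)
    show "inv\<^bsub>L\<^esub> (l (u j)) \<in> V"
      using HV that by (auto simp: H_def)
  qed (use unit[OF that] in \<open>auto simp: L.Units_closed\<close>)
  have gen: "egyptian_elem L V (l x)" "x \<in> carrier R" if "x \<in> \<phi> ` carrier A \<union> u ` {1..t}" for x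
    using that phi uj \<phi>C assms(6) by auto
  \<comment> \<open>\<open>generate_ring\<close> is closed under negation, for which sums of
    reciprocals offer no direct rule. But -1 comes from \<open>A\<close>, and negation is
    multiplication by it.\<close>
  have neg1: "egyptian_elem L V (\<ominus>\<^bsub>L\<^esub> \<one>\<^bsub>L\<^esub>)"
  proof -
    interpret \<phi>: ring_hom_ring A R \<phi>
      using assms(5) by unfold_locales auto
    show ?thesis
      using phi[of "\<ominus>\<^bsub>A\<^esub> \<one>\<^bsub>A\<^esub>"] by simp
  qed
  have R: "egyptian_elem L V (l x)" if "x \<in> carrier R" for x
  proof -
    \<comment> \<open>Membership in the carrier is part of the induction claim because the
      homomorphism rules for \<open>l\<close> require it.\<close>
    have "x \<in> carrier R \<and> egyptian_elem L V (l x)"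
      using that[unfolded assms(7)]
    proof (induction rule: generate_ring.induct)
      case one
      show ?case
        using V.egyptian_elem_inverse[of "\<one>\<^bsub>L\<^esub>" "\<one>\<^bsub>L\<^esub>"] by simp
    next
      case (incl h)
      then show ?case using gen by blast
    next
      case (a_inv h)
      then show ?case
        using V.egyptian_elem_mult[OF _ _ neg1, of "l h"] by (simp add: L.l_minus)
    next
      case (eng_add h1 h2)
      then show ?case by (simp add: V.egyptian_elem_add)
    next
      case (eng_mult h1 h2)
      then show ?case by (simp add: V.egyptian_elem_mult)
    qed
    then show ?thesis ..
  qed
  have "egyptian_elem L V b" if bC: "b \<in> carrier L" for b
  proof -
    obtain r n where r: "r \<in> carrier R" and b: "b = fraction R (powers R p) r (p [^]\<^bsub>R\<^esub> (n::nat))"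
      by (rule P.fraction_cases[OF bC[unfolded L_def]]) (auto simp: powers_def)
    let ?q = "p [^]\<^bsub>R\<^esub> n"
    let ?i = "fraction R (powers R p) \<one>\<^bsub>R\<^esub> ?q"
    have q: "?q \<in> powers R p" "?q \<in> carrier R"
      using p by (auto simp: powers_def)
    have i: "?i \<in> carrier L"
      unfolding L_def using q by (simp add: P.fraction_closed)
    \<comment> \<open>An element of \<open>L\<close> splits into a numerator from \<open>R\<close>,
      handled by the ring generation argument, and the reciprocal of a power of
      \<open>p\<close>.\<close>
    have b': "b = l r \<otimes>\<^bsub>L\<^esub> ?i"
      unfolding b l_def L_def loc_map_def using r q by (simp add: P.fraction_mult)
    \<comment> \<open>This is where the generator \<open>l p\<close> of \<open>V\<close> enters: its
      powers lie in \<open>V\<close>, so their inverses \<open>?i\<close> in \<open>L\<close> are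
      Egyptian.\<close>
    have "l p [^]\<^bsub>L\<^esub> m \<in> V" for m :: nat
      using HV by (induction m) (auto simp: H_def)
    then have "l ?q \<in> V"
      using p by (simp add: l.hom_nat_pow)
    moreover have "l ?q \<otimes>\<^bsub>L\<^esub> ?i = \<one>\<^bsub>L\<^esub>"
      using P.fraction_one_eq_inv[OF q(1)] L.Units_r_inv unfolding l_def L_def by metis
    ultimately have "egyptian_elem L V ?i"
      using i by (intro V.egyptian_elem_inverse)
    then show ?thesis
      unfolding b' using R r i by (intro V.egyptian_elem_mult) auto
  qed
  then show ?thesis
    unfolding Let_def egyptian_ring_def V_def H_def L_def l_def p_def by blast
qed

end
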